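(* $\displaystyle \min\{T_2(3):f\in\mathcal{T}\}=-7$, where for $f\in\mathcal{T}$, $f(z)=z+\sum_{n=2}^\infty a_nz^n$, one sets $T_2(3)=a_3^2-a_4^2$.
   Context: $\mathbb{D}=\{z\in\mathbb{C}:|z|<1\}$. $\mathcal{T}$ is the class of typically real functions: analytic functions $f$ in $\mathbb{D}$, normalized by $f(z)=z+\sum_{n=2}^\infty a_nz^n$, with $(\operatorname{Im} z)(\operatorname{Im} f(z))\ge0$ for $z\in\mathbb{D}$. By a theorem of Robertson, $f\in\mathcal{T}$ if and only if $f(z)=\int_{-1}^1\frac{z}{1-2tz+z^2}\,d\mu(t)$ for some probability measure $\mu$ on $[-1,1]$. In particular all coefficients $a_n$ are real. *)

theory Defs
  imports "HOL-Complex_Analysis.Complex_Analysis"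
begin

definition typically_real :: "(complex \<Rightarrow> complex) set" where
  "typically_real =
     {f. f holomorphic_on ball 0 1 \<and> f 0 = 0 \<and> deriv f 0 = 1 \<and>
         (\<forall>z\<in>ball 0 1. Im z * Im (f z) \<ge> 0)}"

definition taylor_coeff :: "(complex \<Rightarrow> complex) \<Rightarrow> nat \<Rightarrow> complex" where
  "taylor_coeff f n = fps_nth (fps_expansion f 0) n"

text \<open>The second-order Toeplitz determinant \<open>T\<^sub>2(3)\<close>. It is complex-valued here, so that the
  reality of the coefficients of typically real functions is not built into the definition.\<close>
definition toeplitz_2_3 :: "(complex \<Rightarrow> complex) \<Rightarrow> complex" where
  "toeplitz_2_3 f = (taylor_coeff f 3)\<^sup>2 - (taylor_coeff f 4)\<^sup>2"

end

theory Submission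
  imports Defs
begin

text \<open>
  Since \<open>Im f(r e\<^sup>i\<^sup>\<theta>)\<close> has the sign of \<open>sin \<theta>\<close> and \<open>\<pi> r\<^sup>n a\<^sub>n = \<integral> Im f(r e\<^sup>i\<^sup>\<theta>) sin n\<theta> d\<theta>\<close>, every sine
  polynomial \<open>\<Sum> c\<^sub>n sin n\<theta> = sin \<theta> q(cos \<theta>)\<close> with \<open>q \<ge> 0\<close> on \<open>[-1, 1]\<close> gives \<open>\<Sum> c\<^sub>n a\<^sub>n \<ge> 0\<close> after
  \<open>r \<rightarrow> 1\<close>. The choice \<open>7 sin \<theta> + 3 sin 3\<theta> \<plusminus> 4 sin 4\<theta>\<close>, which comes from the tangent to
  \<open>y = sqrt (x\<^sup>2 + 7)\<close> at the point \<open>(3, 4)\<close> of the Koebe function, yields \<open>\<bar>4 a\<^sub>4\<bar> \<le> 3 a\<^sub>3 + 7\<close>,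
  and \<open>16 (a\<^sub>3\<^sup>2 + 7) - (3 a\<^sub>3 + 7)\<^sup>2 = 7 (a\<^sub>3 - 3)\<^sup>2\<close>.
\<close>

section \<open>Reality of the Taylor coefficients\<close>

lemma taylor_coeff_eq_higher_deriv: "taylor_coeff f n = (deriv ^^ n) f 0 / fact n"
  by (simp add: taylor_coeff_def fps_expansion_def)

text \<open>The derivative is already determined by real increments; those difference quotients are
  real, and the real line is closed.\<close>

lemma deriv_real_on_real_axis:
  assumes hol: "f holomorphic_on A" and "open A"
    and real: "\<And>x. of_real x \<in> A \<Longrightarrow> f (of_real x) \<in> \<real>"
    and x: "of_real x \<in> A"
  shows "deriv f (of_real x) \<in> \<real>"
proof -
  have "(f has_field_derivative deriv f (of_real x)) (at (of_real x))"
    using assms holomorphic_derivI by blast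
  then have "((\<lambda>h. (f (of_real x + h) - f (of_real x)) / h) \<longlongrightarrow> deriv f (of_real x)) (at 0)"
    by (simp add: DERIV_def)
  moreover have "filterlim complex_of_real (at 0) (at 0)"
    by (auto simp: filterlim_at eventually_at_filter intro!: tendsto_eq_intros)
  ultimately have lim: "((\<lambda>h::real. (f (of_real x + of_real h) - f (of_real x)) / of_real h)
      \<longlongrightarrow> deriv f (of_real x)) (at 0)"
    by (rule filterlim_compose)
  have "((\<lambda>h::real. complex_of_real (x + h)) \<longlongrightarrow> of_real x) (at 0)"
    by (auto intro!: tendsto_eq_intros)
  then have "eventually (\<lambda>h. complex_of_real (x + h) \<in> A) (at 0)"
    using \<open>open A\<close> x by (rule topological_tendstoD)
  then have "eventually (\<lambda>h::real. (f (of_real x + of_real h) - f (of_real x)) / of_real h \<in> \<real>) (at 0)"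
  proof eventually_elim
    case (elim h)
    then show ?case using real[of "x + h"] real[OF x] by (auto intro!: Reals_divide Reals_diff)
  qed
  then show ?thesis
    using lim closed_complex_Reals by (intro Lim_in_closed_set[of \<real> _ "at (0::real)"]) auto
qed

lemma higher_deriv_real_on_real_axis:
  assumes "f holomorphic_on A" "open A"
    and "\<And>x. of_real x \<in> A \<Longrightarrow> f (of_real x) \<in> \<real>" and "of_real x \<in> A"
  shows "(deriv ^^ n) f (of_real x) \<in> \<real>"
  using assms(4)
proof (induction n arbitrary: x)
  case 0
  then show ?case using assms(3) by simp
next
  case (Suc n)
  then show ?case
    using deriv_real_on_real_axis[OF holomorphic_higher_deriv[OF assms(1,2)] assms(2)] by simp
qed

text \<open>Along the vertical line through \<open>x\<close>, \<open>Im f\<close> is nonnegative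
  above the axis and nonpositive below it, so by continuity it vanishes at \<open>x\<close>.\<close>

lemma typically_real_real_on_real_axis:
  assumes f: "f \<in> typically_real" and x: "complex_of_real x \<in> ball 0 1"
  shows "f (of_real x) \<in> \<real>"
proof -
  have hol: "f holomorphic_on ball 0 1"
    and im: "\<And>z. z \<in> ball 0 1 \<Longrightarrow> Im z * Im (f z) \<ge> 0"
    using f by (auto simp: typically_real_def)
  define g where "g = (\<lambda>t::real. of_real x + \<i> * of_real t)"
  have g: "(g \<longlongrightarrow> of_real x) (at 0)"
    unfolding g_def by (auto intro!: tendsto_eq_intros)
  have "isCont f (of_real x)"
    using holomorphic_on_imp_continuous_on[OF hol] x continuous_on_eq_continuous_at[OF open_ball]
    by blast
  then have lim: "((\<lambda>t. Im (f (g t))) \<longlongrightarrow> Im (f (of_real x))) (at 0)"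
    by (rule tendsto_Im[OF isCont_tendsto_compose[OF _ g]])
  have ev: "eventually (\<lambda>t. g t \<in> ball 0 1) (at 0)"
    using g x by (intro topological_tendstoD) auto
  have "Im (f (of_real x)) \<ge> 0"
  proof (rule tendsto_lowerbound)
    show "((\<lambda>t. Im (f (g t))) \<longlongrightarrow> Im (f (of_real x))) (at_right 0)"
      using lim by (rule tendsto_mono[rotated]) (simp add: at_le)
    have "eventually (\<lambda>t. g t \<in> ball 0 1) (at_right 0)"
      using ev by (rule filter_leD[rotated]) (simp add: at_le)
    then show "eventually (\<lambda>t. 0 \<le> Im (f (g t))) (at_right 0)"
      using eventually_at_right_less[of 0]
    proof eventually_elim
      case (elim t)
      then show ?case using im[OF elim(1)] by (simp add: g_def zero_le_mult_iff)
    qed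
  qed simp
  moreover have "Im (f (of_real x)) \<le> 0"
  proof (rule tendsto_upperbound)
    show "((\<lambda>t. Im (f (g t))) \<longlongrightarrow> Im (f (of_real x))) (at_left 0)"
      using lim by (rule tendsto_mono[rotated]) (simp add: at_le)
    have "eventually (\<lambda>t. g t \<in> ball 0 1) (at_left 0)"
      using ev by (rule filter_leD[rotated]) (simp add: at_le)
    moreover have "eventually (\<lambda>t::real. t < 0) (at_left 0)"
      by (simp add: eventually_at_filter)
    ultimately show "eventually (\<lambda>t. Im (f (g t)) \<le> 0) (at_left 0)"
    proof eventually_elim
      case (elim t)
      then show ?case using im[OF elim(1)] by (simp add: g_def zero_le_mult_iff)
    qed
  qed simp
  ultimately show ?thesis by (simp add: complex_is_Real_iff)
qed

lemma taylor_coeff_typically_real: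
  assumes "f \<in> typically_real"
  shows "taylor_coeff f n \<in> \<real>"
proof -
  have "f holomorphic_on ball 0 1" using assms by (simp add: typically_real_def)
  then have "(deriv ^^ n) f (of_real 0) \<in> \<real>"
    using typically_real_real_on_real_axis[OF assms]
    by (intro higher_deriv_real_on_real_axis[of f "ball 0 1"]) auto
  then show ?thesis
    using Reals_divide[OF _ Reals_of_nat[of "fact n"]] by (simp add: taylor_coeff_eq_higher_deriv)
qed

section \<open>Sine coefficients of Im f on circles\<close>

text \<open>The kernel \<open>z\<^sup>-\<^sup>n\<^sup>-\<^sup>1\<close> extracts the \<open>n\<close>-th coefficient and \<open>z\<^sup>n\<^sup>-\<^sup>1\<close> contributes nothing;
  on the circle of radius \<open>r\<close> their suitably scaled difference is a multiple of \<open>sin (n \<theta>)\<close>.\<close>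

lemma Im_sin_integral_circle:
  assumes hol: "f holomorphic_on ball 0 1" and r: "0 < r" "r < 1" and n: "n > 0"
  shows "((\<lambda>x. Im (f (of_real r * cis (2 * pi * x))) * sin (real n * (2 * pi * x)))
           has_integral r ^ n * Re (taylor_coeff f n) / 2) {0..1}"
proof -
  define c where "c = circlepath 0 r"
  define k where "k = (\<lambda>z. of_real (r ^ n) * (f z / (z - 0) ^ Suc n)
                           - (f z * z ^ (n - 1)) / of_real (r ^ n))"
  have "((\<lambda>z. f z / (z - 0) ^ Suc n) has_contour_integral
          (2 * pi * \<i>) / fact n * (deriv ^^ n) f 0) c"
    unfolding c_def using r
    by (intro Cauchy_has_contour_integral_higher_derivative_circlepath
          holomorphic_on_imp_continuous_on holomorphic_on_subset[OF hol]) auto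
  \<comment> \<open>Since \<open>n > 0\<close>, the exponent \<open>n - 1\<close> is not truncated:
    multiplying by \<open>z\<close> in \<open>c_deriv\<close> turns this kernel into exactly
    \<open>z ^ n\<close>.\<close>
  moreover have "((\<lambda>z. f z * z ^ (n - 1)) has_contour_integral 0) c"
    unfolding c_def using r
    by (intro Cauchy_theorem_convex_simple[of _ "ball 0 1"] holomorphic_intros hol)
       (auto simp: path_image_circlepath_nonneg)
  ultimately have "(k has_contour_integral (of_real (r ^ n) *
      ((2 * pi * \<i>) / fact n * (deriv ^^ n) f 0) - 0 / of_real (r ^ n))) c"
    unfolding k_def
    by (intro has_contour_integral_diff has_contour_integral_lmul has_contour_integral_div)
  then have k_int: "(k has_contour_integral 2 * pi * \<i> * of_real (r ^ n) * taylor_coeff f n) c"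
    by (simp add: taylor_coeff_eq_higher_deriv mult_ac)
  have c_eq: "c x = of_real r * cis (2 * pi * x)" for x
    by (simp add: c_def circlepath cis_conv_exp mult_ac)
  have c_deriv: "vector_derivative c (at x) = 2 * pi * \<i> * c x" for x
    unfolding c_def vector_derivative_circlepath by (simp add: circlepath)
  have k_c: "k (c x) * vector_derivative c (at x)
      = of_real (4 * pi * sin (real n * (2 * pi * x))) * f (c x)" for x
  proof -
    have nz: "c x \<noteq> 0" using r by (simp add: c_eq)
    have c_pow: "c x ^ n = of_real (r ^ n) * cis (real n * (2 * pi * x))"
      unfolding c_eq power_mult_distrib Complex.DeMoivre by simp
    have "c x * k (c x) = f (c x) * (of_real (r ^ n) / c x ^ n - c x ^ n / of_real (r ^ n))"
      using nz n unfolding k_def by (cases n) (simp_all add: field_simps)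
    also have "of_real (r ^ n) / c x ^ n = cis (- (real n * (2 * pi * x)))"
      using r by (simp add: c_pow divide_simps cis_mult)
    also have "c x ^ n / of_real (r ^ n) = cis (real n * (2 * pi * x))"
      using r by (simp add: c_pow)
    also have "cis (- (real n * (2 * pi * x))) - cis (real n * (2 * pi * x))
        = - 2 * \<i> * of_real (sin (real n * (2 * pi * x)))"
      by (simp add: complex_eq_iff)
    finally show ?thesis
      by (simp add: c_deriv mult_ac)
  qed
  \<comment> \<open>The sine weight is real, so \<open>Im\<close> falls on \<open>f\<close> alone;
    on the right the factor \<open>\<i>\<close> turns \<open>Im\<close> into \<open>Re\<close> of
    the coefficient. Dividing by \<open>4 * pi\<close> leaves the factor 1/2.\<close>
  have "((\<lambda>x. Im (of_real (4 * pi * sin (real n * (2 * pi * x))) * f (c x)))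
      has_integral Im (2 * pi * \<i> * of_real (r ^ n) * taylor_coeff f n)) {0..1}"
    using has_integral_linear[OF k_int[unfolded has_contour_integral k_c] bounded_linear_Im]
    by (simp add: o_def)
  from has_integral_mult_right[OF this, of "1 / (4 * pi)"] show ?thesis
    by (simp add: c_eq mult_ac)
qed

section \<open>The nonnegative sine polynomial and the coefficient inequality\<close>

lemma sin_3_eq: "sin (3 * t) = sin t * (4 * (cos t)\<^sup>2 - 1)" for t :: real
proof -
  have "sin (3 * t) = sin (2 * t + t)" by simp
  also have "\<dots> = sin t * (4 * (cos t)\<^sup>2 - 1)"
    unfolding sin_add sin_double cos_double_cos by (simp add: algebra_simps power2_eq_square)
  finally show ?thesis .
qed

lemma sin_4_eq: "sin (4 * t) = sin t * (8 * cos t ^ 3 - 4 * cos t)" for t :: real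
proof -
  have "sin (4 * t) = sin (2 * (2 * t))" by simp
  also have "\<dots> = sin t * (8 * cos t ^ 3 - 4 * cos t)"
    unfolding sin_double[of "2 * t"] sin_double[of t] cos_double_cos
    by (simp add: algebra_simps power2_eq_square power3_eq_cube)
  finally show ?thesis .
qed

text \<open>The cubic is the Chebyshev polynomial of the second kind U_3. The gap
  \<open>3 * u\<^sup>2 + 1 - (8 * u ^ 3 - 4 * u)\<close> vanishes at \<open>u = 1\<close>, and
  splitting off \<open>1 - u\<close> leaves a positive quadratic. Using \<open>u = t\<close> and
  \<open>u = - t\<close> gives the absolute value.\<close>

lemma abs_cubic_le:
  fixes t :: real
  assumes "\<bar>t\<bar> \<le> 1"
  shows "\<bar>8 * t ^ 3 - 4 * t\<bar> \<le> 3 * t\<^sup>2 + 1"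
proof -
  have *: "8 * u ^ 3 - 4 * u \<le> 3 * u\<^sup>2 + 1" if "u \<le> 1" for u :: real
  proof -
    have "8 * u\<^sup>2 + 5 * u + 1 = 8 * (u + 5/16)\<^sup>2 + 7/32"
      by (simp add: power2_eq_square algebra_simps)
    then have "0 \<le> (1 - u) * (8 * u\<^sup>2 + 5 * u + 1)"
      using that by simp
    then show ?thesis by (simp add: algebra_simps power2_eq_square power3_eq_cube)
  qed
  from *[of t] *[of "- t"] assms show ?thesis by (simp add: abs_le_iff)
qed

lemma sin_polynomial_same_sign:
  fixes s t :: real
  assumes "\<bar>s\<bar> = 1"
  obtains q where "q \<ge> 0" "7 * sin t + 3 * sin (3 * t) + 4 * s * sin (4 * t) = sin t * q"
proof
  have "\<bar>s * (8 * cos t ^ 3 - 4 * cos t)\<bar> \<le> 3 * (cos t)\<^sup>2 + 1"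
    using abs_cubic_le[of "cos t"] assms by (simp add: abs_mult)
  \<comment> \<open>The witness comes from dividing out \<open>sin t\<close>: 7 + 3 (4 c^2 - 1) = 4
    (3 c^2 + 1) with c = cos t, and the \<open>sin (4 * t)\<close> term adds 4 s (8 c^3 - 4
    c).\<close>
  then show "4 * (3 * (cos t)\<^sup>2 + 1 + s * (8 * cos t ^ 3 - 4 * cos t)) \<ge> 0"
    by (simp add: abs_le_iff)
  show "7 * sin t + 3 * sin (3 * t) + 4 * s * sin (4 * t)
      = sin t * (4 * (3 * (cos t)\<^sup>2 + 1 + s * (8 * cos t ^ 3 - 4 * cos t)))"
    unfolding sin_3_eq sin_4_eq by (simp add: algebra_simps)
qed

lemma typically_real_coeff_ineq:
  assumes f: "f \<in> typically_real" and s: "\<bar>s\<bar> = 1"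
  shows "0 \<le> 7 + 3 * Re (taylor_coeff f 3) + 4 * s * Re (taylor_coeff f 4)"
proof -
  have hol: "f holomorphic_on ball 0 1" and d: "deriv f 0 = 1"
    and im: "\<And>z. z \<in> ball 0 1 \<Longrightarrow> Im z * Im (f z) \<ge> 0"
    using f by (auto simp: typically_real_def)
  have a1: "taylor_coeff f 1 = 1"
    using d by (simp add: taylor_coeff_eq_higher_deriv)
  \<comment> \<open>For 0 < r < 1, \<open>p r\<close> is twice the integral of \<open>Im f\<close>
    on the circle of radius \<open>r\<close> against the sine polynomial.\<close>
  define p where "p = (\<lambda>r. 7 * r + 3 * (r ^ 3 * Re (taylor_coeff f 3))
                               + 4 * s * (r ^ 4 * Re (taylor_coeff f 4)))"
  have p_nonneg: "0 \<le> p r" if r: "0 < r" "r < 1" for r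
  proof -
    define w where "w = (\<lambda>x. Im (f (of_real r * cis (2 * pi * x))))"
    have "((\<lambda>x. 7 * (w x * sin (real 1 * (2 * pi * x))) + 3 * (w x * sin (real 3 * (2 * pi * x)))
             + 4 * s * (w x * sin (real 4 * (2 * pi * x))))
          has_integral 7 * (r ^ 1 * Re (taylor_coeff f 1) / 2)
             + 3 * (r ^ 3 * Re (taylor_coeff f 3) / 2)
             + 4 * s * (r ^ 4 * Re (taylor_coeff f 4) / 2)) {0..1}"
      unfolding w_def using hol r
      by (intro has_integral_add has_integral_mult_right Im_sin_integral_circle) auto
    then have "0 \<le> 7 * (r ^ 1 * Re (taylor_coeff f 1) / 2)
             + 3 * (r ^ 3 * Re (taylor_coeff f 3) / 2)
             + 4 * s * (r ^ 4 * Re (taylor_coeff f 4) / 2)"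
    proof (rule has_integral_nonneg)
      fix x :: real
      define t where "t = 2 * pi * x"
      obtain q where q: "q \<ge> 0"
        "7 * sin t + 3 * sin (3 * t) + 4 * s * sin (4 * t) = sin t * q"
        using sin_polynomial_same_sign[OF s] by blast
      have "0 \<le> Im (of_real r * cis t) * w x"
        using im[of "of_real r * cis t"] r by (simp add: w_def t_def norm_mult)
      then have "0 \<le> sin t * w x"
        using r by (simp add: mult.assoc zero_le_mult_iff[of r])
      \<comment> \<open>Both \<open>w x\<close> and the sine polynomial have the sign of
        \<open>sin t\<close>, so their product is nonnegative.\<close>
      then have "0 \<le> w x * (7 * sin t + 3 * sin (3 * t) + 4 * s * sin (4 * t))"
        unfolding q(2)
        using mult_nonneg_nonneg[OF q(1), of "sin t * w x"] by (simp add: mult_ac)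
      then show "0 \<le> 7 * (w x * sin (real 1 * (2 * pi * x))) + 3 * (w x * sin (real 3 * (2 * pi * x)))
             + 4 * s * (w x * sin (real 4 * (2 * pi * x)))"
        unfolding t_def[symmetric] by (simp add: algebra_simps)
    qed
    then show ?thesis unfolding p_def a1 by simp
  qed
  have "(p \<longlongrightarrow> p 1) (at_left 1)"
    unfolding p_def by (intro tendsto_intros)
  moreover have "eventually (\<lambda>r. 0 \<le> p r) (at_left 1)"
    using eventually_at_left_real[of 0 1] by (rule eventually_mono) (auto intro: p_nonneg)
  ultimately have "0 \<le> p 1"
    by (intro tendsto_lowerbound) auto
  then show ?thesis by (simp add: p_def)
qed

section \<open>The Koebe function as extremal function\<close>

lemma koebe_has_fps_expansion:
  "(\<lambda>z::complex. z / (1 - z)\<^sup>2) has_fps_expansion Abs_fps of_nat"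
proof -
  define F :: "complex fps" where "F = Abs_fps of_nat"
  have nz: "(1 - fps_X)\<^sup>2 \<noteq> (0 :: complex fps)"
    by simp
  have "F * (1 - fps_X)\<^sup>2 = F - fps_X * F - fps_X * F + fps_X * (fps_X * F)"
    by (simp add: power2_eq_square algebra_simps)
  \<comment> \<open>Multiplying by (1 - X)^2 takes second differences: n - 2 (n - 1) + (n - 2) = 0
    for n at least 2. The indices 0 and 1 are separate because the shifted terms have no coefficient
    there to subtract.\<close>
  also have "\<dots> = fps_X"
  proof (rule fps_ext)
    fix n
    show "fps_nth (F - fps_X * F - fps_X * F + fps_X * (fps_X * F)) n = fps_nth fps_X n"
      by (cases "n \<le> 1") (auto simp: F_def le_Suc_eq fps_X_mult_nth fps_X_nth of_nat_diff)
  qed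
  finally have "fps_X / (1 - fps_X)\<^sup>2 = F"
    by (metis nonzero_mult_div_cancel_right nz)
  moreover have "(\<lambda>z::complex. z / (1 - z)\<^sup>2) has_fps_expansion fps_X / (1 - fps_X)\<^sup>2"
    by (intro fps_expansion_intros) auto
  ultimately show ?thesis by (simp add: F_def)
qed

lemma taylor_coeff_koebe: "taylor_coeff (\<lambda>z. z / (1 - z)\<^sup>2) n = of_nat n"
  using fps_nth_fps_expansion[OF koebe_has_fps_expansion, of n]
  by (simp add: taylor_coeff_eq_higher_deriv)

lemma koebe_typically_real: "(\<lambda>z. z / (1 - z)\<^sup>2) \<in> typically_real"
proof -
  have "deriv (\<lambda>z::complex. z / (1 - z)\<^sup>2) 0 = 1"
    using taylor_coeff_koebe[of 1] by (simp add: taylor_coeff_eq_higher_deriv)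
  moreover have "(\<lambda>z::complex. z / (1 - z)\<^sup>2) holomorphic_on ball 0 1"
    by (intro holomorphic_intros) auto
  moreover have "0 \<le> Im z * Im (z / (1 - z)\<^sup>2)" if "z \<in> ball 0 1" for z :: complex
  proof -
    have "Im (z / (1 - z)\<^sup>2) = Im (z * cnj ((1 - z)\<^sup>2)) / (cmod ((1 - z)\<^sup>2))\<^sup>2"
      by (simp only: complex_div_cnj[of z] Im_divide_of_real of_real_power[symmetric])
    \<comment> \<open>Expanding the square gives z - 2 |z|^2 + |z|^2 \<open>cnj z\<close>, whose
      middle term is real.\<close>
    also have "Im (z * cnj ((1 - z)\<^sup>2)) = Im z * (1 - (cmod z)\<^sup>2)"
      unfolding cmod_power2 by (simp add: power2_eq_square algebra_simps)
    finally have "Im z * Im (z / (1 - z)\<^sup>2)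
        = (Im z)\<^sup>2 * (1 - (cmod z)\<^sup>2) / (cmod ((1 - z)\<^sup>2))\<^sup>2"
      by (simp add: power2_eq_square)
    also have "\<dots> \<ge> 0"
      using that by (intro divide_nonneg_nonneg mult_nonneg_nonneg) (auto simp: power_le_one)
    finally show ?thesis .
  qed
  ultimately show ?thesis by (simp add: typically_real_def)
qed

theorem theorem2p9:
  shows "(\<exists>f\<in>typically_real. toeplitz_2_3 f = -7) \<and>
         (\<forall>f\<in>typically_real. toeplitz_2_3 f \<in> \<real> \<and> -7 \<le> Re (toeplitz_2_3 f))"
proof (intro conjI ballI)
  show "\<exists>f\<in>typically_real. toeplitz_2_3 f = -7"
    using koebe_typically_real by (rule bexI[rotated]) (simp add: toeplitz_2_3_def taylor_coeff_koebe)
next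
  fix f assume f: "f \<in> typically_real"
  show "toeplitz_2_3 f \<in> \<real>"
    unfolding toeplitz_2_3_def using taylor_coeff_typically_real[OF f] by auto
  define x y where "x = Re (taylor_coeff f 3)" and "y = Re (taylor_coeff f 4)"
  have "taylor_coeff f 3 = of_real x" "taylor_coeff f 4 = of_real y"
    using taylor_coeff_typically_real[OF f] by (simp_all add: x_def y_def)
  then have eq: "Re (toeplitz_2_3 f) = x\<^sup>2 - y\<^sup>2"
    by (simp add: toeplitz_2_3_def flip: of_real_power)
  \<comment> \<open>The two choices of the sign \<open>s\<close> bound \<open>4 * y\<close> from
    below and from above.\<close>
  have "\<bar>4 * y\<bar> \<le> 3 * x + 7"
    using typically_real_coeff_ineq[OF f, of 1] typically_real_coeff_ineq[OF f, of "-1"]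
    by (simp add: x_def y_def abs_le_iff)
  then have "16 * y\<^sup>2 \<le> (3 * x + 7)\<^sup>2"
    using power_mono[of "\<bar>4 * y\<bar>" "3 * x + 7" 2] by (simp add: power_mult_distrib)
  also have "\<dots> = 16 * (x\<^sup>2 + 7) - 7 * (x - 3)\<^sup>2"
    by (simp add: power2_eq_square algebra_simps)
  finally have "16 * y\<^sup>2 \<le> 16 * (x\<^sup>2 + 7)"
    using zero_le_power2[of "x - 3"] by linarith
  then show "-7 \<le> Re (toeplitz_2_3 f)"
    unfolding eq by simp
qed

end
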